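(* Let $\mathcal S=(\mathcal M,\mathcal C,T_l,T_r,\Pi,t,i)$ be an admissible septuple and let $w:T_rX\to T_lX$ be a transposition morphism with respect to $\mathcal S$, where $X$ is an object of $\mathcal M$. For $n\ge 0$ let $Z^n(\mathcal S,X):=\Pi T_l^{\,n+1}X$, with coface morphisms $d_k:=\Pi T_l^{k}u_{T_l}T_l^{n-k}X:\Pi T_l^{n}X\to\Pi T_l^{n+1}X$ and codegeneracy morphisms $s_k:=\Pi T_l^{k}m_{T_l}T_l^{n-k}X:\Pi T_l^{n+2}X\to \Pi T_l^{n+1}X$, for $k\in\{0,\dots,n\}$. Then the cosimplicial object $Z^\ast(\mathcal S,X)$ in $\mathcal C$ is para-cocyclic with respect to the morphisms $$w_n:=\Pi T_l^{n}w\circ t_nX\circ iT_l^{n}X:\ \Pi T_l^{n+1}X\to\Pi T_l^{n+1}X .$$ Denote this para-cocyclic object by $Z^\ast(\mathcal S,w)$. For every morphism $f:(X,w)\to(X',w')$ in $\mathcal W_{\mathcal S}$, the morphisms $\Pi T_l^{n+1}f:Z^n(\mathcal S,w)\to Z^n(\mathcal S,w')$ determine a morphism of para-cocyclic objects.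
   Context: Horizontal composition of functors and natural transformations is denoted by juxtaposition, vertical composition by $\circ$. A monad on $\mathcal M$ is a triple $(T,m_T,u_T)$ with $T:\mathcal M\to\mathcal M$ a functor and $m_T:T^2\to T$, $u_T:\mathrm{Id}\to T$ an associative multiplication and a unit. A distributive law between monads $R$ and $T$ is a natural transformation $t:RT\to TR$ with $t\circ m_RT=Tm_R\circ tR\circ Rt$, $t\circ Rm_T=m_TR\circ Tt\circ tT$, $t\circ u_RT=Tu_R$, $t\circ Ru_T=u_TR$. An admissible septuple $\mathcal S=(\mathcal M,\mathcal C,T_l,T_r,\Pi,t,i)$ consists of categories $\mathcal M,\mathcal C$; monads $T_l,T_r$ on $\mathcal M$; a functor $\Pi:\mathcal M\to\mathcal C$; a distributive law $t:T_rT_l\to T_lT_r$; and a natural transformation $i:\Pi T_l\to\Pi T_r$, such that $i\circ\Pi u_{T_l}=\Pi u_{T_r}$ and $i\circ\Pi m_{T_l}=\Pi m_{T_r}\circ iT_r\circ\Pi t\circ iT_l$. The natural transformation $t_n:\Pi T_rT_l^n\to\Pi T_l^nT_r$ is $t_n:=\Pi T_l^{n-1}t\circ\Pi T_l^{n-2}tT_l\circ\dots\circ\Pi T_l\,t\,T_l^{n-2}\circ\Pi t\,T_l^{n-1}$ (the identity if $n=0$). A transposition morphism with respect to $\mathcal S$ is a morphism $w:T_rX\to T_lX$ in $\mathcal M$ with $w\circ u_{T_r}X=u_{T_l}X$ and $w\circ m_{T_r}X=m_{T_l}X\circ T_lw\circ tX\circ T_rw$. The category $\mathcal W_{\mathcal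 S}$ has as objects the pairs $(X,w)$ with $w:T_rX\to T_lX$ a transposition morphism; a morphism $(X,w)\to(X',w')$ is a morphism $f:X\to X'$ in $\mathcal M$ with $T_lf\circ w=w'\circ T_rf$. A para-cocyclic object is a cosimplicial object $(Z^n,d_k:Z^{n-1}\to Z^n,s_k:Z^{n+1}\to Z^n)$ with morphisms $w_n:Z^n\to Z^n$ satisfying $w_n d_0=d_n$, $w_nd_k=d_{k-1}w_{n-1}$, $w_ns_0=s_n(w_{n+1})^2$, $w_ns_k=s_{k-1}w_{n+1}$ for $1\le k\le n$ (the relations with cofaces being required for $n\ge1$). Morphisms of para-cocyclic objects are morphisms of cosimplicial objects commuting with the $w_n$. *)

theory Defs
  imports Main
begin

section \<open>Categories, functors and natural transformations\<close>

record ('o, 'm) cat =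
  Obj :: "'o set"
  Arr :: "'m set"
  Dom :: "'m \<Rightarrow> 'o"
  Cod :: "'m \<Rightarrow> 'o"
  Ide :: "'o \<Rightarrow> 'm"
  Comp :: "'m \<Rightarrow> 'm \<Rightarrow> 'm"  (infixr "\<cdot>\<index>" 70)

definition hom :: "('o, 'm) cat \<Rightarrow> 'o \<Rightarrow> 'o \<Rightarrow> 'm set" where
  "hom C X Y = {f \<in> Arr C. Dom C f = X \<and> Cod C f = Y}"

locale category =
  fixes C :: "('o, 'm) cat" (structure)
  assumes dom_obj: "f \<in> Arr C \<Longrightarrow> Dom C f \<in> Obj C"
    and cod_obj: "f \<in> Arr C \<Longrightarrow> Cod C f \<in> Obj C"
    and ide_hom: "X \<in> Obj C \<Longrightarrow> Ide C X \<in> hom C X X"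
    and comp_hom: "\<lbrakk>f \<in> hom C X Y; g \<in> hom C Y Z\<rbrakk> \<Longrightarrow> g \<cdot> f \<in> hom C X Z"
    and comp_ide: "f \<in> hom C X Y \<Longrightarrow> f \<cdot> Ide C X = f"
    and ide_comp: "f \<in> hom C X Y \<Longrightarrow> Ide C Y \<cdot> f = f"
    and comp_assoc: "\<lbrakk>f \<in> hom C X Y; g \<in> hom C Y Z; h \<in> hom C Z W\<rbrakk>
                      \<Longrightarrow> (h \<cdot> g) \<cdot> f = h \<cdot> (g \<cdot> f)"

text \<open>The values of a functor, or of a natural transformation, at arguments that are not objects
  or arrows of the source category are irrelevant.\<close>

record ('o, 'm, 'p, 'n) fctr =
  fo :: "'o \<Rightarrow> 'p"
  fa :: "'m \<Rightarrow> 'n"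

locale is_functor = A: category A + B: category B
  for A :: "('o, 'm) cat" and B :: "('p, 'n) cat" +
  fixes F :: "('o, 'm, 'p, 'n) fctr"
  assumes obj_map: "X \<in> Obj A \<Longrightarrow> fo F X \<in> Obj B"
    and arr_map: "f \<in> hom A X Y \<Longrightarrow> fa F f \<in> hom B (fo F X) (fo F Y)"
    and map_ide: "X \<in> Obj A \<Longrightarrow> fa F (Ide A X) = Ide B (fo F X)"
    and map_comp: "\<lbrakk>f \<in> hom A X Y; g \<in> hom A Y Z\<rbrakk>
                    \<Longrightarrow> fa F (g \<cdot>\<^bsub>A\<^esub> f) = fa F g \<cdot>\<^bsub>B\<^esub> fa F f"

definition fid :: "('o, 'm, 'o, 'm) fctr" where
  "fid = \<lparr>fo = (\<lambda>X. X), fa = (\<lambda>f. f)\<rparr>"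

definition fcomp ::
  "('p, 'n, 'q, 'k) fctr \<Rightarrow> ('o, 'm, 'p, 'n) fctr \<Rightarrow> ('o, 'm, 'q, 'k) fctr"
  (infixr "\<odot>" 75) where
  "G \<odot> F = \<lparr>fo = (\<lambda>X. fo G (fo F X)), fa = (\<lambda>f. fa G (fa F f))\<rparr>"

primrec fpow :: "('o, 'm, 'o, 'm) fctr \<Rightarrow> nat \<Rightarrow> ('o, 'm, 'o, 'm) fctr" where
  "fpow T 0 = fid"
| "fpow T (Suc n) = T \<odot> fpow T n"

text \<open>A natural transformation is given by its components, indexed by the objects of the source.\<close>

locale nat_trans = F: is_functor A B F + G: is_functor A B G
  for A :: "('o, 'm) cat" and B :: "('p, 'n) cat"
    and F :: "('o, 'm, 'p, 'n) fctr" and G :: "('o, 'm, 'p, 'n) fctr" +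
  fixes \<eta> :: "'o \<Rightarrow> 'n"
  assumes component: "X \<in> Obj A \<Longrightarrow> \<eta> X \<in> hom B (fo F X) (fo G X)"
    and naturality: "f \<in> hom A X Y \<Longrightarrow> \<eta> Y \<cdot>\<^bsub>B\<^esub> fa F f = fa G f \<cdot>\<^bsub>B\<^esub> \<eta> X"

definition nt_eq :: "('o, 'm) cat \<Rightarrow> ('o \<Rightarrow> 'n) \<Rightarrow> ('o \<Rightarrow> 'n) \<Rightarrow> bool" where
  "nt_eq A \<sigma> \<tau> \<longleftrightarrow> (\<forall>X \<in> Obj A. \<sigma> X = \<tau> X)"

definition nt_id :: "('p, 'n) cat \<Rightarrow> ('o, 'm, 'p, 'n) fctr \<Rightarrow> 'o \<Rightarrow> 'n" where
  "nt_id B F = (\<lambda>X. Ide B (fo F X))"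

text \<open>Vertical composition, for transformations between functors into \<open>B\<close>.\<close>

definition vcomp :: "('p, 'n) cat \<Rightarrow> ('o \<Rightarrow> 'n) \<Rightarrow> ('o \<Rightarrow> 'n) \<Rightarrow> 'o \<Rightarrow> 'n"
  (infixr "\<bullet>\<index>" 65) where
  "\<sigma> \<bullet>\<^bsub>B\<^esub> \<tau> = (\<lambda>X. \<sigma> X \<cdot>\<^bsub>B\<^esub> \<tau> X)"

text \<open>Horizontal composition is only needed with an identity transformation on one side:
  \<open>F \<lhd> \<eta>\<close> and \<open>\<eta> \<rhd> F\<close> are what is written \<open>F\<eta>\<close> and \<open>\<eta>F\<close> by juxtaposition.\<close>

definition lwhisk :: "('p, 'n, 'q, 'k) fctr \<Rightarrow> ('o \<Rightarrow> 'n) \<Rightarrow> 'o \<Rightarrow> 'k"  (infixr "\<lhd>" 72) where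
  "F \<lhd> \<eta> = (\<lambda>X. fa F (\<eta> X))"

definition rwhisk :: "('p \<Rightarrow> 'k) \<Rightarrow> ('o, 'm, 'p, 'n) fctr \<Rightarrow> 'o \<Rightarrow> 'k"  (infixl "\<rhd>" 73) where
  "\<eta> \<rhd> F = (\<lambda>X. \<eta> (fo F X))"


section \<open>Monads, distributive laws and admissible septuples\<close>

record ('o, 'm) mnd =
  mfun :: "('o, 'm, 'o, 'm) fctr"
  mmul :: "'o \<Rightarrow> 'm"
  munit :: "'o \<Rightarrow> 'm"

definition is_monad :: "('o, 'm) cat \<Rightarrow> ('o, 'm) mnd \<Rightarrow> bool" where
  "is_monad M T \<longleftrightarrow>
     is_functor M M (mfun T) \<and>
     nat_trans M M (mfun T \<odot> mfun T) (mfun T) (mmul T) \<and>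
     nat_trans M M fid (mfun T) (munit T) \<and>
     nt_eq M (mmul T \<bullet>\<^bsub>M\<^esub> mfun T \<lhd> mmul T) (mmul T \<bullet>\<^bsub>M\<^esub> mmul T \<rhd> mfun T) \<and>
     nt_eq M (mmul T \<bullet>\<^bsub>M\<^esub> munit T \<rhd> mfun T) (nt_id M (mfun T)) \<and>
     nt_eq M (mmul T \<bullet>\<^bsub>M\<^esub> mfun T \<lhd> munit T) (nt_id M (mfun T))"

definition distributive_law ::
  "('o, 'm) cat \<Rightarrow> ('o, 'm) mnd \<Rightarrow> ('o, 'm) mnd \<Rightarrow> ('o \<Rightarrow> 'm) \<Rightarrow> bool" where
  "distributive_law M R T t \<longleftrightarrow>
     is_monad M R \<and> is_monad M T \<and>
     nat_trans M M (mfun R \<odot> mfun T) (mfun T \<odot> mfun R) t \<and>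
     nt_eq M (t \<bullet>\<^bsub>M\<^esub> mmul R \<rhd> mfun T)
             (mfun T \<lhd> mmul R \<bullet>\<^bsub>M\<^esub> t \<rhd> mfun R \<bullet>\<^bsub>M\<^esub> mfun R \<lhd> t) \<and>
     nt_eq M (t \<bullet>\<^bsub>M\<^esub> mfun R \<lhd> mmul T)
             (mmul T \<rhd> mfun R \<bullet>\<^bsub>M\<^esub> mfun T \<lhd> t \<bullet>\<^bsub>M\<^esub> t \<rhd> mfun T) \<and>
     nt_eq M (t \<bullet>\<^bsub>M\<^esub> munit R \<rhd> mfun T) (mfun T \<lhd> munit R) \<and>
     nt_eq M (t \<bullet>\<^bsub>M\<^esub> mfun R \<lhd> munit T) (munit T \<rhd> mfun R)"

record ('o, 'm, 'p, 'n) septuple =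
  catM :: "('o, 'm) cat"
  catC :: "('p, 'n) cat"
  mndL :: "('o, 'm) mnd"
  mndR :: "('o, 'm) mnd"
  PiF :: "('o, 'm, 'p, 'n) fctr"
  tlaw :: "'o \<Rightarrow> 'm"
  itr :: "'o \<Rightarrow> 'n"

abbreviation Tl :: "('o, 'm, 'p, 'n) septuple \<Rightarrow> ('o, 'm, 'o, 'm) fctr" where
  "Tl S \<equiv> mfun (mndL S)"

abbreviation Tr :: "('o, 'm, 'p, 'n) septuple \<Rightarrow> ('o, 'm, 'o, 'm) fctr" where
  "Tr S \<equiv> mfun (mndR S)"

definition admissible_septuple :: "('o, 'm, 'p, 'n) septuple \<Rightarrow> bool" where
  "admissible_septuple S \<longleftrightarrow>
     category (catM S) \<and> category (catC S) \<and>
     is_monad (catM S) (mndL S) \<and> is_monad (catM S) (mndR S) \<and>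
     is_functor (catM S) (catC S) (PiF S) \<and>
     distributive_law (catM S) (mndR S) (mndL S) (tlaw S) \<and>
     nat_trans (catM S) (catC S) (PiF S \<odot> Tl S) (PiF S \<odot> Tr S) (itr S) \<and>
     nt_eq (catM S) (itr S \<bullet>\<^bsub>catC S\<^esub> PiF S \<lhd> munit (mndL S)) (PiF S \<lhd> munit (mndR S)) \<and>
     nt_eq (catM S)
       (itr S \<bullet>\<^bsub>catC S\<^esub> PiF S \<lhd> mmul (mndL S))
       (PiF S \<lhd> mmul (mndR S) \<bullet>\<^bsub>catC S\<^esub> itr S \<rhd> Tr S \<bullet>\<^bsub>catC S\<^esub>
        PiF S \<lhd> tlaw S \<bullet>\<^bsub>catC S\<^esub> itr S \<rhd> Tl S)"

text \<open>\<open>t_partial S n k\<close> is the composite of the \<open>k\<close> rightmost (first applied) factors of \<open>t\<^sub>n\<close>;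
  the factor added in step \<open>k\<close> is \<open>\<Pi> T\<^sub>l\<^sup>k t T\<^sub>l\<^sup>n\<^sup>-\<^sup>1\<^sup>-\<^sup>k\<close>.\<close>

primrec t_partial :: "('o, 'm, 'p, 'n) septuple \<Rightarrow> nat \<Rightarrow> nat \<Rightarrow> 'o \<Rightarrow> 'n" where
  "t_partial S n 0 = nt_id (catC S) (PiF S \<odot> Tr S \<odot> fpow (Tl S) n)"
| "t_partial S n (Suc k) =
     (PiF S \<odot> fpow (Tl S) k) \<lhd> tlaw S \<rhd> fpow (Tl S) (n - 1 - k) \<bullet>\<^bsub>catC S\<^esub> t_partial S n k"

definition t_iter :: "('o, 'm, 'p, 'n) septuple \<Rightarrow> nat \<Rightarrow> 'o \<Rightarrow> 'n" where
  "t_iter S n = t_partial S n n"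


section \<open>Transposition morphisms\<close>

definition transposition_morphism :: "('o, 'm, 'p, 'n) septuple \<Rightarrow> 'o \<Rightarrow> 'm \<Rightarrow> bool" where
  "transposition_morphism S X w \<longleftrightarrow>
     X \<in> Obj (catM S) \<and>
     w \<in> hom (catM S) (fo (Tr S) X) (fo (Tl S) X) \<and>
     w \<cdot>\<^bsub>catM S\<^esub> munit (mndR S) X = munit (mndL S) X \<and>
     w \<cdot>\<^bsub>catM S\<^esub> mmul (mndR S) X =
       mmul (mndL S) X \<cdot>\<^bsub>catM S\<^esub> fa (Tl S) w \<cdot>\<^bsub>catM S\<^esub> tlaw S X \<cdot>\<^bsub>catM S\<^esub> fa (Tr S) w"

text \<open>An arrow of \<open>\<W>\<^sub>S\<close> is a triple consisting of its source, the underlying arrow of the base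
  category, and its target.\<close>

definition W_cat ::
  "('o, 'm, 'p, 'n) septuple \<Rightarrow> ('o \<times> 'm, ('o \<times> 'm) \<times> 'm \<times> ('o \<times> 'm)) cat" where
  "W_cat S =
     \<lparr>Obj = {(X, w). transposition_morphism S X w},
      Arr = {((X, w), f, (X', w')) | X w f X' w'.
               transposition_morphism S X w \<and> transposition_morphism S X' w' \<and>
               f \<in> hom (catM S) X X' \<and>
               fa (Tl S) f \<cdot>\<^bsub>catM S\<^esub> w = w' \<cdot>\<^bsub>catM S\<^esub> fa (Tr S) f},
      Dom = fst,
      Cod = (\<lambda>p. snd (snd p)),
      Ide = (\<lambda>(X, w). ((X, w), Ide (catM S) X, (X, w))),
      Comp = (\<lambda>q p. (fst p, fst (snd q) \<cdot>\<^bsub>catM S\<^esub> fst (snd p), snd (snd q)))\<rparr>"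

definition W_under :: "('o \<times> 'm) \<times> 'm \<times> ('o \<times> 'm) \<Rightarrow> 'm" where
  "W_under p = fst (snd p)"


lemma W_category:
  assumes "admissible_septuple S"
  shows "category (W_cat S)"
proof -
  let ?M = "catM S"
  note hom_W = hom_def[of "\<lparr>Obj = a, Arr = b, Dom = c, Cod = d, Ide = e, Comp = g\<rparr>" for a b c d e g]
  interpret L: is_functor ?M ?M "Tl S"
    using assms by (simp add: admissible_septuple_def is_monad_def)
  interpret R: is_functor ?M ?M "Tr S"
    using assms by (simp add: admissible_septuple_def is_monad_def)
  show ?thesis
  proof (standard, goal_cases)
    case (1 f) then show ?case by (auto simp: W_cat_def)
  next
    case (2 f) then show ?case by (auto simp: W_cat_def)
  next
    case (3 P)
    then show ?case
      by (auto simp: W_cat_def transposition_morphism_def hom_W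
          L.map_ide R.map_ide L.A.ide_hom L.A.ide_comp L.A.comp_ide)
  next
    case (4 p P Q q R)
    then obtain X w f X' w' g X'' w'' where p: "p = ((X,w),f,(X',w'))" "P = (X,w)" "Q = (X',w')"
      and q: "q = ((X',w'),g,(X'',w''))" "R = (X'',w'')"
      and t: "transposition_morphism S X w" "transposition_morphism S X' w'" "transposition_morphism S X'' w''"
      and f: "f \<in> hom ?M X X'" "fa (Tl S) f \<cdot>\<^bsub>?M\<^esub> w = w' \<cdot>\<^bsub>?M\<^esub> fa (Tr S) f"
      and g: "g \<in> hom ?M X' X''" "fa (Tl S) g \<cdot>\<^bsub>?M\<^esub> w' = w'' \<cdot>\<^bsub>?M\<^esub> fa (Tr S) g"
      by (auto simp: W_cat_def hom_W)
    note w = t[unfolded transposition_morphism_def]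
    have h: "w \<in> hom ?M (fo (Tr S) X) (fo (Tl S) X)" "w' \<in> hom ?M (fo (Tr S) X') (fo (Tl S) X')"
      "w'' \<in> hom ?M (fo (Tr S) X'') (fo (Tl S) X'')" using w by auto
    note lf = L.arr_map[OF f(1)] L.arr_map[OF g(1)] R.arr_map[OF f(1)] R.arr_map[OF g(1)]
    have "fa (Tl S) (g \<cdot>\<^bsub>?M\<^esub> f) \<cdot>\<^bsub>?M\<^esub> w = w'' \<cdot>\<^bsub>?M\<^esub> fa (Tr S) (g \<cdot>\<^bsub>?M\<^esub> f)"
      unfolding L.map_comp[OF f(1) g(1)] R.map_comp[OF f(1) g(1)]
        L.A.comp_assoc[OF h(1) lf(1,2)] f(2) L.A.comp_assoc[OF lf(3) h(2) lf(2), symmetric] g(2)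
        L.A.comp_assoc[OF lf(3,4) h(3)] ..
    then show ?case using t L.A.comp_hom[OF f(1) g(1)] unfolding p q
      by (auto simp: W_cat_def hom_W)
  next
    case 5 then show ?case using L.A.comp_ide by (auto simp: W_cat_def hom_W)
  next
    case 6 then show ?case using L.A.ide_comp by (auto simp: W_cat_def hom_W)
  next
    case 7 then show ?case using L.A.comp_assoc by (auto simp: W_cat_def hom_W)
  qed
qed


section \<open>Cosimplicial and para-cocyclic objects\<close>

text \<open>The superscript of the target is the first index: \<open>coface Z n k : Z\<^sup>n\<^sup>-\<^sup>1 \<rightarrow> Z\<^sup>n\<close>, used only for
  \<open>n \<ge> 1\<close>, and \<open>codeg Z n k : Z\<^sup>n\<^sup>+\<^sup>1 \<rightarrow> Z\<^sup>n\<close>; in both cases \<open>k \<le> n\<close>.\<close>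

record ('p, 'n) cosimp =
  cobj :: "nat \<Rightarrow> 'p"
  coface :: "nat \<Rightarrow> nat \<Rightarrow> 'n"
  codeg :: "nat \<Rightarrow> nat \<Rightarrow> 'n"

locale cosimplicial_object = category C
  for C :: "('p, 'n) cat" (structure) +
  fixes Z :: "('p, 'n) cosimp"
  assumes cobj_obj: "cobj Z n \<in> Obj C"
    and coface_hom: "\<lbrakk>1 \<le> n; k \<le> n\<rbrakk> \<Longrightarrow> coface Z n k \<in> hom C (cobj Z (n - 1)) (cobj Z n)"
    and codeg_hom: "k \<le> n \<Longrightarrow> codeg Z n k \<in> hom C (cobj Z (n + 1)) (cobj Z n)"
    and coface_coface: "\<lbrakk>1 \<le> n; i < j; j \<le> n + 1\<rbrakk> \<Longrightarrow>
          coface Z (n + 1) j \<cdot> coface Z n i = coface Z (n + 1) i \<cdot> coface Z n (j - 1)"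
    and codeg_codeg: "\<lbrakk>i \<le> j; j \<le> n\<rbrakk> \<Longrightarrow>
          codeg Z n j \<cdot> codeg Z (n + 1) i = codeg Z n i \<cdot> codeg Z (n + 1) (j + 1)"
    and codeg_coface_less: "\<lbrakk>i < j; j \<le> n\<rbrakk> \<Longrightarrow>
          codeg Z n j \<cdot> coface Z (n + 1) i = coface Z n i \<cdot> codeg Z (n - 1) (j - 1)"
    and codeg_coface_eq: "\<lbrakk>j \<le> n; i = j \<or> i = j + 1\<rbrakk> \<Longrightarrow>
          codeg Z n j \<cdot> coface Z (n + 1) i = Ide C (cobj Z n)"
    and codeg_coface_greater: "\<lbrakk>j + 1 < i; i \<le> n + 1\<rbrakk> \<Longrightarrow>
          codeg Z n j \<cdot> coface Z (n + 1) i = coface Z n (i - 1) \<cdot> codeg Z (n - 1) j"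

locale para_cocyclic_object = cosimplicial_object C Z
  for C :: "('p, 'n) cat" (structure) and Z :: "('p, 'n) cosimp" +
  fixes w :: "nat \<Rightarrow> 'n"
  assumes cyc_hom: "w n \<in> hom C (cobj Z n) (cobj Z n)"
    and cyc_coface_0: "1 \<le> n \<Longrightarrow> w n \<cdot> coface Z n 0 = coface Z n n"
    and cyc_coface: "\<lbrakk>1 \<le> k; k \<le> n\<rbrakk> \<Longrightarrow> w n \<cdot> coface Z n k = coface Z n (k - 1) \<cdot> w (n - 1)"
    and cyc_codeg_0: "w n \<cdot> codeg Z n 0 = codeg Z n n \<cdot> w (n + 1) \<cdot> w (n + 1)"
    and cyc_codeg: "\<lbrakk>1 \<le> k; k \<le> n\<rbrakk> \<Longrightarrow> w n \<cdot> codeg Z n k = codeg Z n (k - 1) \<cdot> w (n + 1)"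

locale para_cocyclic_morphism =
  src: para_cocyclic_object C Z w + tgt: para_cocyclic_object C Z' w'
  for C :: "('p, 'n) cat" (structure) and Z :: "('p, 'n) cosimp" and w :: "nat \<Rightarrow> 'n"
    and Z' :: "('p, 'n) cosimp" and w' :: "nat \<Rightarrow> 'n" +
  fixes \<phi> :: "nat \<Rightarrow> 'n"
  assumes mor_hom: "\<phi> n \<in> hom C (cobj Z n) (cobj Z' n)"
    and mor_coface: "\<lbrakk>1 \<le> n; k \<le> n\<rbrakk> \<Longrightarrow> \<phi> n \<cdot> coface Z n k = coface Z' n k \<cdot> \<phi> (n - 1)"
    and mor_codeg: "k \<le> n \<Longrightarrow> \<phi> n \<cdot> codeg Z n k = codeg Z' n k \<cdot> \<phi> (n + 1)"
    and mor_cyc: "\<phi> n \<cdot> w n = w' n \<cdot> \<phi> n"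

definition Z_cosimp :: "('o, 'm, 'p, 'n) septuple \<Rightarrow> 'o \<Rightarrow> ('p, 'n) cosimp" where
  "Z_cosimp S X =
     \<lparr>cobj = (\<lambda>n. fo (PiF S \<odot> fpow (Tl S) (n + 1)) X),
      coface = (\<lambda>n k. ((PiF S \<odot> fpow (Tl S) k) \<lhd> munit (mndL S) \<rhd> fpow (Tl S) (n - k)) X),
      codeg = (\<lambda>n k. ((PiF S \<odot> fpow (Tl S) k) \<lhd> mmul (mndL S) \<rhd> fpow (Tl S) (n - k)) X)\<rparr>"

definition Z_cyc :: "('o, 'm, 'p, 'n) septuple \<Rightarrow> 'o \<Rightarrow> 'm \<Rightarrow> nat \<Rightarrow> 'n" where
  "Z_cyc S X w n =
     fa (PiF S \<odot> fpow (Tl S) n) w \<cdot>\<^bsub>catC S\<^esub> t_iter S n X \<cdot>\<^bsub>catC S\<^esub> (itr S \<rhd> fpow (Tl S) n) X"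

end

theory Submission
  imports Defs
begin

text \<open>The operator \<open>w\<^sub>n\<close> is \<open>\<Pi> \<omega>\<^sub>n \<circ> i T\<^sub>l\<^sup>n X\<close>, where \<open>\<omega>\<^sub>n : T\<^sub>r T\<^sub>l\<^sup>n X \<rightarrow> T\<^sub>l\<^sup>n\<^sup>+\<^sup>1 X\<close> lives in \<open>\<M>\<close> and
  satisfies \<open>\<omega>\<^sub>0 = w\<close> and \<open>\<omega>\<^sub>n\<^sub>+\<^sub>1 = T\<^sub>l \<omega>\<^sub>n \<circ> t T\<^sub>l\<^sup>n X\<close>. By induction on \<open>n\<close>, the axioms of the
  distributive law and of a transposition morphism give
  \<open>\<omega>\<^sub>n \<circ> u\<^sub>r = T\<^sub>l\<^sup>n u\<^sub>l\<close>, \<open>\<omega>\<^sub>n \<circ> m\<^sub>r = T\<^sub>l\<^sup>n m\<^sub>l \<circ> \<omega>\<^sub>n\<^sub>+\<^sub>1 \<circ> T\<^sub>r \<omega>\<^sub>n\<close>, and that \<open>\<omega>\<close> commutes with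
  the inner units and multiplications. Applying \<open>\<Pi>\<close> and the axioms and naturality of \<open>i\<close>
  yields the para-cocyclic relations.\<close>

text \<open>Typing is restated through \<open>Dom\<close> and \<open>Cod\<close>, so that the simplifier can discharge the side
  conditions of associativity and functoriality without guessing intermediate objects.\<close>

context category
begin

lemma homI: "\<lbrakk>f \<in> Arr C; Dom C f = X; Cod C f = Y\<rbrakk> \<Longrightarrow> f \<in> hom C X Y"
  by (simp add: hom_def)

lemma comp_arr:
  assumes "f \<in> Arr C" "g \<in> Arr C" "Dom C g = Cod C f"
  shows "g \<cdot> f \<in> Arr C" "Dom C (g \<cdot> f) = Dom C f" "Cod C (g \<cdot> f) = Cod C g"
  using comp_hom[of f "Dom C f" "Cod C f" g "Cod C g"] assms by (auto simp: hom_def)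

lemma ide_arr:
  assumes "X \<in> Obj C"
  shows "Ide C X \<in> Arr C" "Dom C (Ide C X) = X" "Cod C (Ide C X) = X"
  using ide_hom[OF assms] by (auto simp: hom_def)

lemma comp_ide_arr: "\<lbrakk>f \<in> Arr C; Dom C f = X\<rbrakk> \<Longrightarrow> f \<cdot> Ide C X = f"
  using comp_ide[of f X "Cod C f"] by (simp add: hom_def)

lemma ide_comp_arr: "\<lbrakk>f \<in> Arr C; Cod C f = Y\<rbrakk> \<Longrightarrow> Ide C Y \<cdot> f = f"
  using ide_comp[of f "Dom C f" Y] by (simp add: hom_def)

lemma comp_assoc_arr:
  "\<lbrakk>f \<in> Arr C; g \<in> Arr C; h \<in> Arr C; Dom C g = Cod C f; Dom C h = Cod C g\<rbrakk>
    \<Longrightarrow> (h \<cdot> g) \<cdot> f = h \<cdot> g \<cdot> f"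
  using comp_assoc[of f "Dom C f" "Cod C f" g "Cod C g" h "Cod C h"] by (simp add: hom_def)

text \<open>Simplification nests composites to the right, so a commuting square inside a longer
  chain no longer occurs as a subterm. This form carries the tail \<open>x\<close> along.\<close>

lemma comp_eq_tail:
  assumes "g \<cdot> f = h \<cdot> k"
    and "f \<in> Arr C" "g \<in> Arr C" "Dom C g = Cod C f"
    and "k \<in> Arr C" "h \<in> Arr C" "Dom C h = Cod C k"
    and "x \<in> Arr C" "Dom C f = Cod C x"
  shows "g \<cdot> f \<cdot> x = h \<cdot> k \<cdot> x"
proof -
  have "Dom C k = Cod C x"
    using comp_arr(2)[OF assms(2-4)] comp_arr(2)[OF assms(5-7)] assms(1,9) by simp
  then show ?thesis
    using assms comp_assoc_arr[of x f g] comp_assoc_arr[of x k h] by simp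
qed

lemmas arr_simps = comp_arr ide_arr comp_ide_arr ide_comp_arr comp_assoc_arr dom_obj cod_obj

end

context is_functor
begin

lemma fa_arr:
  assumes "f \<in> Arr A"
  shows "fa F f \<in> Arr B" "Dom B (fa F f) = fo F (Dom A f)" "Cod B (fa F f) = fo F (Cod A f)"
  using arr_map[of f "Dom A f" "Cod A f"] assms by (auto simp: hom_def)

lemma fa_comp:
  "\<lbrakk>f \<in> Arr A; g \<in> Arr A; Dom A g = Cod A f\<rbrakk> \<Longrightarrow> fa F (g \<cdot>\<^bsub>A\<^esub> f) = fa F g \<cdot>\<^bsub>B\<^esub> fa F f"
  using map_comp[of f "Dom A f" "Cod A f" g "Cod A g"] by (auto simp: hom_def)

lemmas fun_simps = fa_arr fa_comp map_ide obj_map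

end

context nat_trans
begin

lemma component_arr:
  assumes "X \<in> Obj A"
  shows "\<eta> X \<in> Arr B" "Dom B (\<eta> X) = fo F X" "Cod B (\<eta> X) = fo G X"
  using component[OF assms] by (auto simp: hom_def)

lemma naturality_arr:
  "\<lbrakk>f \<in> Arr A; Dom A f = X; Cod A f = Y\<rbrakk> \<Longrightarrow> \<eta> Y \<cdot>\<^bsub>B\<^esub> fa F f = fa G f \<cdot>\<^bsub>B\<^esub> \<eta> X"
  using naturality[of f X Y] by (simp add: hom_def)

end

section \<open>Powers of an endofunctor and index arithmetic\<close>

lemma fid_sel [simp]: "fo fid X = X" "fa fid f = f"
  by (simp_all add: fid_def)

lemma fcomp_sel [simp]: "fo (G \<odot> F) X = fo G (fo F X)" "fa (G \<odot> F) f = fa G (fa F f)"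
  by (simp_all add: fcomp_def)

lemma fpow_add:
  "fo (fpow T (a + b)) X = fo (fpow T a) (fo (fpow T b) X)"
  "fa (fpow T (a + b)) f = fa (fpow T a) (fa (fpow T b) f)"
  by (induction a) simp_all

text \<open>With \<open>fpow_add\<close> this gives a normal form for iterated functors: a single
  \<open>T\<close> is moved outside the powers.\<close>

lemma fpow_swap:
  "fo (fpow T n) (fo T X) = fo T (fo (fpow T n) X)"
  "fa (fpow T n) (fa T f) = fa T (fa (fpow T n) f)"
  by (induction n) simp_all

lemma fpow_functor:
  assumes "is_functor A A F"
  shows "is_functor A A (fpow F n)"
proof -
  interpret F: is_functor A A F by fact
  show ?thesis
  proof (induction n)
    case 0
    show ?case by standard simp_all
  next
    case (Suc n)
    then interpret P: is_functor A A "fpow F n" .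
    show ?case
      by standard (auto simp: P.obj_map F.obj_map P.map_ide F.map_ide intro: F.arr_map P.arr_map
          F.map_comp[OF P.arr_map P.arr_map] simp: P.map_comp)
  qed
qed

text \<open>Writing the larger index as a sum removes truncated subtractions such as
  \<open>n - k\<close> and makes \<open>fpow_add\<close> applicable.\<close>

lemma le_obtain:
  assumes "x \<le> (y::nat)" obtains c where "y = x + c"
  using assms le_Suc_ex by blast

lemma less_obtain:
  assumes "x < (y::nat)" obtains c where "y = x + Suc c"
  using assms less_imp_Suc_add by (metis add_Suc_right)

section \<open>Admissible septuples in components and the iterated distributive law\<close>

locale admissible =
  fixes S :: "('o, 'm, 'p, 'n) septuple"
  assumes admissible: "admissible_septuple S"
begin

abbreviation "M \<equiv> catM S"
abbreviation "C \<equiv> catC S"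
abbreviation "L \<equiv> fo (Tl S)"
abbreviation "l \<equiv> fa (Tl S)"
abbreviation "R \<equiv> fo (Tr S)"
abbreviation "r \<equiv> fa (Tr S)"
abbreviation "P \<equiv> fo (PiF S)"
abbreviation "p \<equiv> fa (PiF S)"
abbreviation "Ln n \<equiv> fo (fpow (Tl S) n)"
abbreviation "ln n \<equiv> fa (fpow (Tl S) n)"
abbreviation "ml \<equiv> mmul (mndL S)"
abbreviation "ul \<equiv> munit (mndL S)"
abbreviation "mr \<equiv> mmul (mndR S)"
abbreviation "ur \<equiv> munit (mndR S)"
abbreviation "t \<equiv> tlaw S"
abbreviation "i \<equiv> itr S"

sublocale M: category M using admissible by (simp add: admissible_septuple_def)
sublocale C: category C using admissible by (simp add: admissible_septuple_def)
sublocale L: is_functor M M "Tl S" using admissible by (simp add: admissible_septuple_def is_monad_def)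
sublocale R: is_functor M M "Tr S" using admissible by (simp add: admissible_septuple_def is_monad_def)
sublocale P: is_functor M C "PiF S" using admissible by (simp add: admissible_septuple_def)
sublocale Ln: is_functor M M "fpow (Tl S) n" for n
  by (rule fpow_functor) unfold_locales
sublocale ml: nat_trans M M "Tl S \<odot> Tl S" "Tl S" ml
  using admissible by (simp add: admissible_septuple_def is_monad_def)
sublocale ul: nat_trans M M fid "Tl S" ul
  using admissible by (simp add: admissible_septuple_def is_monad_def)
sublocale mr: nat_trans M M "Tr S \<odot> Tr S" "Tr S" mr
  using admissible by (simp add: admissible_septuple_def is_monad_def)
sublocale ur: nat_trans M M fid "Tr S" ur
  using admissible by (simp add: admissible_septuple_def is_monad_def)
sublocale t: nat_trans M M "Tr S \<odot> Tl S" "Tl S \<odot> Tr S" t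
  using admissible by (simp add: admissible_septuple_def distributive_law_def)
sublocale i: nat_trans M C "PiF S \<odot> Tl S" "PiF S \<odot> Tr S" i
  using admissible by (simp add: admissible_septuple_def)

lemmas [simp] = M.arr_simps C.arr_simps L.fun_simps R.fun_simps P.fun_simps Ln.fun_simps
  ml.component_arr[simplified] ul.component_arr[simplified] mr.component_arr[simplified]
  ur.component_arr[simplified] t.component_arr[simplified] i.component_arr[simplified]

lemmas ml_nat = ml.naturality_arr[simplified]
lemmas ul_nat = ul.naturality_arr[simplified]
lemmas t_nat = t.naturality_arr[simplified]
lemmas i_nat = i.naturality_arr[simplified]

lemma monad_laws:
  assumes "Y \<in> Obj M"
  shows "ml Y \<cdot>\<^bsub>M\<^esub> l (ml Y) = ml Y \<cdot>\<^bsub>M\<^esub> ml (L Y)"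
    and "ml Y \<cdot>\<^bsub>M\<^esub> ul (L Y) = Ide M (L Y)"
    and "ml Y \<cdot>\<^bsub>M\<^esub> l (ul Y) = Ide M (L Y)"
  using admissible assms
  by (simp_all add: admissible_septuple_def is_monad_def nt_eq_def vcomp_def lwhisk_def rwhisk_def nt_id_def)

lemma t_laws:
  assumes "Y \<in> Obj M"
  shows "t Y \<cdot>\<^bsub>M\<^esub> mr (L Y) = l (mr Y) \<cdot>\<^bsub>M\<^esub> t (R Y) \<cdot>\<^bsub>M\<^esub> r (t Y)"
    and "t Y \<cdot>\<^bsub>M\<^esub> r (ml Y) = ml (R Y) \<cdot>\<^bsub>M\<^esub> l (t Y) \<cdot>\<^bsub>M\<^esub> t (L Y)"
    and "t Y \<cdot>\<^bsub>M\<^esub> ur (L Y) = l (ur Y)"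
    and "t Y \<cdot>\<^bsub>M\<^esub> r (ul Y) = ul (R Y)"
  using admissible assms
  by (simp_all add: admissible_septuple_def distributive_law_def nt_eq_def vcomp_def lwhisk_def rwhisk_def)

lemma i_laws:
  assumes "Y \<in> Obj M"
  shows "i Y \<cdot>\<^bsub>C\<^esub> p (ul Y) = p (ur Y)"
    and "i Y \<cdot>\<^bsub>C\<^esub> p (ml Y) = p (mr Y) \<cdot>\<^bsub>C\<^esub> i (R Y) \<cdot>\<^bsub>C\<^esub> p (t Y) \<cdot>\<^bsub>C\<^esub> i (L Y)"
  using admissible assms
  by (simp_all add: admissible_septuple_def nt_eq_def vcomp_def lwhisk_def rwhisk_def)

text \<open>\<open>t\<^sub>n = \<Pi> (lam n)\<close>, but built by adding the factors at the other end, so that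
  \<open>om n = T\<^sub>l\<^sup>n w \<circ> lam n\<close> below satisfies a recursion with \<open>X\<close> fixed.\<close>

primrec lam :: "nat \<Rightarrow> 'o \<Rightarrow> 'm" where
  "lam 0 Y = Ide M (R Y)"
| "lam (Suc n) Y = l (lam n Y) \<cdot>\<^bsub>M\<^esub> t (Ln n Y)"

lemma lam_arr [simp]:
  assumes "Y \<in> Obj M"
  shows "lam n Y \<in> Arr M" "Dom M (lam n Y) = R (Ln n Y)" "Cod M (lam n Y) = Ln n (R Y)"
  using assms by (induction n) simp_all

text \<open>The same composite with its last applied factor split off, which is the end where
  \<open>t_partial\<close> grows.\<close>

lemma lam_Suc_right:
  assumes "Y \<in> Obj M"
  shows "lam (Suc n) Y = ln n (t Y) \<cdot>\<^bsub>M\<^esub> lam n (L Y)"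
  using assms
proof (induction n)
  case (Suc n)
  show ?case
    by (subst lam.simps, subst Suc.IH[OF Suc.prems]) (simp add: Suc.prems fpow_swap)
qed simp

text \<open>After \<open>k\<close> factors \<open>Tr S\<close> has passed \<open>k\<close> copies of
  \<open>Tl S\<close>; the other \<open>n - k\<close> copies only enlarge the argument. For
  \<open>k = n\<close> this identifies \<open>t_iter\<close>.\<close>

lemma t_partial_eq:
  assumes "Y \<in> Obj M" "k \<le> n"
  shows "t_partial S n k Y = p (lam k (Ln (n - k) Y))"
  using assms(2)
proof (induction k)
  case 0
  show ?case using assms by (simp add: nt_id_def)
next
  case (Suc k)
  then have "n - k = Suc (n - 1 - k)" by simp
  then have "lam k (Ln (n - k) Y) = lam k (L (Ln (n - 1 - k) Y))" by simp
  with Suc show ?case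
    using assms(1)
    by (simp add: vcomp_def lwhisk_def rwhisk_def lam_Suc_right del: lam.simps)
qed

end

section \<open>The cyclic operator of a transposition morphism\<close>

locale transposition = admissible S for S :: "('o, 'm, 'p, 'n) septuple" +
  fixes X :: 'o and w :: 'm
  assumes transposition: "transposition_morphism S X w"
begin

lemma X_obj [simp]: "X \<in> Obj M"
  using transposition by (simp add: transposition_morphism_def)

lemma w_arr [simp]: "w \<in> Arr M" "Dom M w = R X" "Cod M w = L X"
  using transposition by (simp_all add: transposition_morphism_def hom_def)

lemma w_laws:
  "w \<cdot>\<^bsub>M\<^esub> ur X = ul X"
  "w \<cdot>\<^bsub>M\<^esub> mr X = ml X \<cdot>\<^bsub>M\<^esub> l w \<cdot>\<^bsub>M\<^esub> t X \<cdot>\<^bsub>M\<^esub> r w"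
  using transposition by (simp_all add: transposition_morphism_def)

primrec om :: "nat \<Rightarrow> 'm" where
  "om 0 = w"
| "om (Suc n) = l (om n) \<cdot>\<^bsub>M\<^esub> t (Ln n X)"

lemma om_arr [simp]: "om n \<in> Arr M" "Dom M (om n) = R (Ln n X)" "Cod M (om n) = L (Ln n X)"
  by (induction n) simp_all

lemma om_eq_lam: "om n = ln n w \<cdot>\<^bsub>M\<^esub> lam n X"
  by (induction n) simp_all

lemma Z_cyc_eq: "Z_cyc S X w n = p (om n) \<cdot>\<^bsub>C\<^esub> i (Ln n X)"
  by (simp add: Z_cyc_def t_iter_def t_partial_eq om_eq_lam rwhisk_def)

text \<open>The unit law of \<open>t\<close> moves \<open>ur\<close> under one copy of
  \<open>Tl S\<close> per step; the unit law of \<open>w\<close> ends the descent.\<close>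

lemma om_ur: "om n \<cdot>\<^bsub>M\<^esub> ur (Ln n X) = ln n (ul X)"
proof (induction n)
  case (Suc n)
  have "om (Suc n) \<cdot>\<^bsub>M\<^esub> ur (Ln (Suc n) X) = l (om n \<cdot>\<^bsub>M\<^esub> ur (Ln n X))"
    by (simp add: t_laws)
  then show ?case by (simp only: Suc.IH fpow.simps fcomp_sel)
qed (simp add: w_laws)

lemma om_mr: "om n \<cdot>\<^bsub>M\<^esub> mr (Ln n X) = ln n (ml X) \<cdot>\<^bsub>M\<^esub> om (Suc n) \<cdot>\<^bsub>M\<^esub> r (om n)"
proof (induction n)
  case (Suc n)
  let ?Y = "Ln n X"
  have "om (Suc n) \<cdot>\<^bsub>M\<^esub> mr (Ln (Suc n) X) = l (om n \<cdot>\<^bsub>M\<^esub> mr ?Y) \<cdot>\<^bsub>M\<^esub> t (R ?Y) \<cdot>\<^bsub>M\<^esub> r (t ?Y)"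
    by (simp add: t_laws)
  also have "\<dots> = l (ln n (ml X)) \<cdot>\<^bsub>M\<^esub> l (om (Suc n)) \<cdot>\<^bsub>M\<^esub> (l (r (om n)) \<cdot>\<^bsub>M\<^esub> t (R ?Y)) \<cdot>\<^bsub>M\<^esub> r (t ?Y)"
    unfolding Suc.IH by (simp add: fpow_swap)
  also have "l (r (om n)) \<cdot>\<^bsub>M\<^esub> t (R ?Y) = t (L ?Y) \<cdot>\<^bsub>M\<^esub> r (l (om n))"
    \<comment> \<open>Naturality separates the two copies of \<open>t\<close>: one completes
      \<open>om (Suc (Suc n))\<close>, the other lies in \<open>r (om (Suc n))\<close>.\<close>
    by (rule t_nat[symmetric]) simp_all
  finally show ?case by (simp add: fpow_swap)
qed (simp add: w_laws)

text \<open>For \<open>a = 0\<close> the unit is innermost to \<open>t\<close> alone: its law with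
  \<open>ul\<close> and naturality of \<open>ul\<close> suffice. Each further outer
  \<open>Tl S\<close> costs one naturality square of \<open>t\<close>.\<close>

lemma om_ul: "om (Suc (a + b)) \<cdot>\<^bsub>M\<^esub> r (ln a (ul (Ln b X))) = ln a (ul (L (Ln b X))) \<cdot>\<^bsub>M\<^esub> om (a + b)"
proof (induction a)
  case 0
  show ?case by (simp add: t_laws ul_nat)
next
  case (Suc a)
  have "t (Ln (Suc (a + b)) X) \<cdot>\<^bsub>M\<^esub> r (l (ln a (ul (Ln b X))))
      = l (r (ln a (ul (Ln b X)))) \<cdot>\<^bsub>M\<^esub> t (Ln (a + b) X)"
    by (rule t_nat) (simp_all add: fpow_add fpow_swap)
  then have "om (Suc (Suc a + b)) \<cdot>\<^bsub>M\<^esub> r (ln (Suc a) (ul (Ln b X)))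
      = l (om (Suc (a + b)) \<cdot>\<^bsub>M\<^esub> r (ln a (ul (Ln b X)))) \<cdot>\<^bsub>M\<^esub> t (Ln (a + b) X)"
    by (simp add: fpow_add fpow_swap)
  then show ?case unfolding Suc.IH by (simp add: fpow_add fpow_swap)
qed

lemma om_ml: "om (Suc (a + b)) \<cdot>\<^bsub>M\<^esub> r (ln a (ml (Ln b X)))
  = ln a (ml (L (Ln b X))) \<cdot>\<^bsub>M\<^esub> om (Suc (Suc (a + b)))"
proof (induction a)
  case 0
  have "l (om b) \<cdot>\<^bsub>M\<^esub> ml (R (Ln b X)) = ml (L (Ln b X)) \<cdot>\<^bsub>M\<^esub> l (l (om b))"
    by (rule ml_nat[symmetric]) simp_all
  \<comment> \<open>The tail is what the law of \<open>t\<close> with \<open>ml\<close> leaves: two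
    copies of \<open>t\<close>, which turn \<open>l (l (om b))\<close> into
    \<open>om (Suc (Suc b))\<close>.\<close>
  from M.comp_eq_tail[OF this, of "l (t (Ln b X)) \<cdot>\<^bsub>M\<^esub> t (L (Ln b X))"]
  show ?case by (simp add: t_laws)
next
  case (Suc a)
  have "t (Ln (Suc (a + b)) X) \<cdot>\<^bsub>M\<^esub> r (l (ln a (ml (Ln b X))))
      = l (r (ln a (ml (Ln b X)))) \<cdot>\<^bsub>M\<^esub> t (Ln (Suc (Suc (a + b))) X)"
    by (rule t_nat) (simp_all add: fpow_add fpow_swap)
  then have "om (Suc (Suc a + b)) \<cdot>\<^bsub>M\<^esub> r (ln (Suc a) (ml (Ln b X)))
      = l (om (Suc (a + b)) \<cdot>\<^bsub>M\<^esub> r (ln a (ml (Ln b X)))) \<cdot>\<^bsub>M\<^esub> t (Ln (Suc (Suc (a + b))) X)"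
    by (simp add: fpow_add fpow_swap)
  then show ?case unfolding Suc.IH by (simp add: fpow_add fpow_swap)
qed

lemma Z_cyc_arr [simp]:
  "Z_cyc S X w n \<in> Arr C" "Dom C (Z_cyc S X w n) = P (L (Ln n X))"
  "Cod C (Z_cyc S X w n) = P (L (Ln n X))"
  by (simp_all add: Z_cyc_eq)

text \<open>Naturality of \<open>i\<close> turns the outermost \<open>l\<close> into
  \<open>r\<close>, reducing the claim to an identity for \<open>om\<close>. The loss of that outer
  copy explains the shift from \<open>k\<close> to \<open>k - 1\<close> in the cyclic
  relations.\<close>

lemma Z_cyc_natural:
  assumes f: "f \<in> Arr M" "Cod M f = Ln n X" "Dom M f = Ln n' X"
    and g: "g \<in> Arr M" "Dom M g = L (Ln n' X)"
    and eq: "om n \<cdot>\<^bsub>M\<^esub> r f = g \<cdot>\<^bsub>M\<^esub> om n'"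
  shows "Z_cyc S X w n \<cdot>\<^bsub>C\<^esub> p (l f) = p g \<cdot>\<^bsub>C\<^esub> Z_cyc S X w n'"
proof -
  have "Z_cyc S X w n \<cdot>\<^bsub>C\<^esub> p (l f) = p (om n \<cdot>\<^bsub>M\<^esub> r f) \<cdot>\<^bsub>C\<^esub> i (Ln n' X)"
    using f i_nat[OF f(1,3,2)] by (simp add: Z_cyc_eq)
  then show ?thesis unfolding eq using g by (simp add: Z_cyc_eq)
qed

lemma Z_cyc_codeg_0:
  "Z_cyc S X w n \<cdot>\<^bsub>C\<^esub> p (ml (Ln n X))
    = p (ln n (ml X)) \<cdot>\<^bsub>C\<^esub> Z_cyc S X w (Suc n) \<cdot>\<^bsub>C\<^esub> Z_cyc S X w (Suc n)"
proof -
  let ?Y = "Ln n X"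
  have nat: "i (L ?Y) \<cdot>\<^bsub>C\<^esub> p (l (om n)) = p (r (om n)) \<cdot>\<^bsub>C\<^esub> i (R ?Y)"
    by (rule i_nat) simp_all
  have "Z_cyc S X w n \<cdot>\<^bsub>C\<^esub> p (ml ?Y)
      = p (om n \<cdot>\<^bsub>M\<^esub> mr ?Y) \<cdot>\<^bsub>C\<^esub> i (R ?Y) \<cdot>\<^bsub>C\<^esub> p (t ?Y) \<cdot>\<^bsub>C\<^esub> i (L ?Y)"
    by (simp add: Z_cyc_eq i_laws)
  also have "\<dots> = p (ln n (ml X)) \<cdot>\<^bsub>C\<^esub> p (om (Suc n)) \<cdot>\<^bsub>C\<^esub>
      p (r (om n)) \<cdot>\<^bsub>C\<^esub> i (R ?Y) \<cdot>\<^bsub>C\<^esub> p (t ?Y) \<cdot>\<^bsub>C\<^esub> i (L ?Y)"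
    unfolding om_mr by (simp add: fpow_swap)
  \<comment> \<open>Moving \<open>om n\<close> across \<open>i\<close> regroups the chain into two
    cyclic operators, since \<open>l (om n)\<close> after \<open>t ?Y\<close> is
    \<open>om (Suc n)\<close>.\<close>
  also have "p (r (om n)) \<cdot>\<^bsub>C\<^esub> i (R ?Y) \<cdot>\<^bsub>C\<^esub> p (t ?Y) \<cdot>\<^bsub>C\<^esub> i (L ?Y)
      = i (L ?Y) \<cdot>\<^bsub>C\<^esub> p (l (om n)) \<cdot>\<^bsub>C\<^esub> p (t ?Y) \<cdot>\<^bsub>C\<^esub> i (L ?Y)"
    by (rule C.comp_eq_tail[OF nat, symmetric]) simp_all
  finally show ?thesis by (simp add: Z_cyc_eq fpow_swap)
qed

end

section \<open>The cosimplicial object\<close>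

context admissible
begin

lemma Z_cosimp_sel:
  "cobj (Z_cosimp S X) n = P (L (Ln n X))"
  "coface (Z_cosimp S X) n k = p (ln k (ul (Ln (n - k) X)))"
  "codeg (Z_cosimp S X) n k = p (ln k (ml (Ln (n - k) X)))"
  by (simp_all add: Z_cosimp_def lwhisk_def rwhisk_def)

text \<open>Every cosimplicial identity is the image under \<open>\<Pi> T\<^sub>l\<^sup>a\<close> of a monad law or of a naturality
  square of \<open>u\<close> or \<open>m\<close>.\<close>

lemma p_ln_cong:
  assumes "g \<cdot>\<^bsub>M\<^esub> f = h \<cdot>\<^bsub>M\<^esub> k"
    and "f \<in> Arr M" "g \<in> Arr M" "Dom M g = Cod M f"
    and "k \<in> Arr M" "h \<in> Arr M" "Dom M h = Cod M k"
  shows "p (ln a g) \<cdot>\<^bsub>C\<^esub> p (ln a f) = p (ln a h) \<cdot>\<^bsub>C\<^esub> p (ln a k)"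
  using arg_cong[OF assms(1), of "\<lambda>x. p (ln a x)"] assms(2-) by simp

lemma cosimplicial_Z:
  assumes X [simp]: "X \<in> Obj M"
  shows "cosimplicial_object C (Z_cosimp S X)"
proof (unfold_locales, goal_cases)
  case (1 n)
  show ?case by (simp add: Z_cosimp_sel)
next
  case (2 n k)
  then obtain a where n: "n = k + a" by (blast elim: le_obtain)
  from 2 obtain b where b: "n = Suc b" by (cases n) auto
  have "n - k = a" "n - 1 = b" using n b by simp_all
  moreover have "Ln k (Ln a X) = L (Ln b X)" using n b by (metis fpow_add(1) fpow.simps(2) fcomp_sel(1))
  ultimately show ?case
    by (auto intro!: C.homI simp: Z_cosimp_sel fpow_swap b)
next
  case (3 k n)
  then obtain a where n: "n = k + a" by (blast elim: le_obtain)
  show ?case by (auto intro!: C.homI simp: Z_cosimp_sel n fpow_add fpow_swap)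
next
  case (4 n a j)
  then obtain c where j: "j = a + Suc c" by (blast elim: less_obtain)
  with 4 obtain b where n: "n = a + c + b" by (auto elim: le_obtain)
  have "l (ln c (ul (Ln b X))) \<cdot>\<^bsub>M\<^esub> ul (Ln c (Ln b X)) = ul (L (Ln c (Ln b X))) \<cdot>\<^bsub>M\<^esub> ln c (ul (Ln b X))"
    by (rule ul_nat[symmetric]) (simp_all add: fpow_swap)
  from p_ln_cong[OF this, of a] show ?case
    by (simp add: Z_cosimp_sel n j fpow_add fpow_swap)
next
  case (5 a j n)
  show ?case
  \<comment> \<open>Equal indices give associativity; otherwise one multiplication acts inside the
    argument of the other, and naturality of \<open>ml\<close> applies.\<close>
  proof (cases "a = j")
    case True
    with 5 obtain b where n: "n = a + b" by (auto elim: le_obtain)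
    from p_ln_cong[OF monad_laws(1)[of "Ln b X", symmetric], of a]
    show ?thesis by (simp add: Z_cosimp_sel n True[symmetric] fpow_add fpow_swap)
  next
    case False
    with 5 have "a < j" by simp
    then obtain c where j: "j = a + Suc c" by (blast elim: less_obtain)
    with 5 obtain b where n: "n = a + Suc c + b" by (auto elim: le_obtain)
    have "l (ln c (ml (Ln b X))) \<cdot>\<^bsub>M\<^esub> ml (L (L (Ln c (Ln b X))))
       = ml (L (Ln c (Ln b X))) \<cdot>\<^bsub>M\<^esub> l (l (ln c (ml (Ln b X))))"
      by (rule ml_nat[symmetric]) (simp_all add: fpow_swap)
    from p_ln_cong[OF this, of a] show ?thesis
      by (simp add: Z_cosimp_sel n j fpow_add fpow_swap)
  qed
next
  case (6 a j n)
  then obtain c where j: "j = a + Suc c" by (blast elim: less_obtain)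
  with 6 obtain b where n: "n = a + Suc c + b" by (auto elim: le_obtain)
  have "l (ln c (ml (Ln b X))) \<cdot>\<^bsub>M\<^esub> ul (L (L (Ln c (Ln b X))))
     = ul (L (Ln c (Ln b X))) \<cdot>\<^bsub>M\<^esub> ln c (ml (Ln b X))"
    by (rule ul_nat[symmetric]) (simp_all add: fpow_swap)
  from p_ln_cong[OF this, of a] show ?case
    by (simp add: Z_cosimp_sel n j fpow_add fpow_swap)
next
  case (7 j n k)
  then obtain b where n: "n = j + b" by (auto elim: le_obtain)
  \<comment> \<open>The cofaces with index \<open>j\<close> and \<open>j + 1\<close> correspond to
    the two unit laws.\<close>
  have "p (ln j (ml (Ln b X) \<cdot>\<^bsub>M\<^esub> ul (L (Ln b X)))) = Ide C (cobj (Z_cosimp S X) n)"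
    "p (ln j (ml (Ln b X) \<cdot>\<^bsub>M\<^esub> l (ul (Ln b X)))) = Ide C (cobj (Z_cosimp S X) n)"
    by (simp_all only: monad_laws X Ln.obj_map)
      (simp_all add: Z_cosimp_sel n fpow_add fpow_swap)
  with 7(2) show ?case
    by (auto simp: Z_cosimp_sel n fpow_add fpow_swap)
next
  case (8 j k n)
  then have "Suc j < k" by simp
  then obtain c where k: "k = Suc j + Suc c" by (blast elim: less_obtain)
  with 8 obtain b where n: "n = Suc j + c + b" by (auto elim: le_obtain)
  have "ml (L (Ln c (Ln b X))) \<cdot>\<^bsub>M\<^esub> l (l (ln c (ul (Ln b X))))
     = l (ln c (ul (Ln b X))) \<cdot>\<^bsub>M\<^esub> ml (Ln c (Ln b X))"
    by (rule ml_nat) (simp_all add: fpow_swap)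
  from p_ln_cong[OF this, of j] show ?case
    by (simp add: Z_cosimp_sel n k fpow_add fpow_swap)
qed

end

section \<open>The para-cocyclic relations and their functoriality\<close>

lemma (in transposition) para_cocyclic_Z:
  "para_cocyclic_object C (Z_cosimp S X) (Z_cyc S X w)"
proof -
  interpret Z: cosimplicial_object C "Z_cosimp S X" by (rule cosimplicial_Z) simp
  show ?thesis
  proof (unfold_locales, goal_cases)
    case (1 n)
    show ?case by (rule C.homI) (simp_all add: Z_cosimp_sel)
  next
    case (2 n)
    \<comment> \<open>The unit axiom of \<open>i\<close> replaces \<open>ul\<close> by
      \<open>ur\<close>, so \<open>om_ur\<close> applies.\<close>
    have "Z_cyc S X w n \<cdot>\<^bsub>C\<^esub> p (ul (Ln n X)) = p (om n \<cdot>\<^bsub>M\<^esub> ur (Ln n X))"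
      by (simp add: Z_cyc_eq i_laws)
    then show ?case unfolding om_ur by (simp add: Z_cosimp_sel)
  next
    case (3 k n)
    then obtain a where k: "k = Suc a" by (cases k) auto
    with 3 obtain b where n: "n = Suc (a + b)" by (auto elim: le_obtain)
    show ?case
      using Z_cyc_natural[OF _ _ _ _ _ om_ul[of a b]]
      by (simp add: Z_cosimp_sel n k fpow_add fpow_swap)
  next
    case (4 n)
    show ?case using Z_cyc_codeg_0[of n] by (simp add: Z_cosimp_sel)
  next
    case (5 k n)
    then obtain a where k: "k = Suc a" by (cases k) auto
    with 5 obtain b where n: "n = Suc (a + b)" by (auto elim: le_obtain)
    show ?case
      using Z_cyc_natural[OF _ _ _ _ _ om_ml[of a b]]
      by (simp add: Z_cosimp_sel n k fpow_add fpow_swap)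
  qed
qed

text \<open>Cofaces and codegeneracies are respected by naturality of \<open>ul\<close> and
  \<open>ml\<close>. For the cyclic operators, \<open>om\<close> is shown to be natural in the pair
  \<open>(X, w)\<close>, starting from the condition \<open>fw\<close>.\<close>

lemma (in admissible) para_cocyclic_morphism_Z:
  assumes w: "transposition_morphism S X w" and w': "transposition_morphism S X' w'"
    and f: "f \<in> hom M X X'" and fw: "l f \<cdot>\<^bsub>M\<^esub> w = w' \<cdot>\<^bsub>M\<^esub> r f"
  shows "para_cocyclic_morphism C (Z_cosimp S X) (Z_cyc S X w) (Z_cosimp S X') (Z_cyc S X' w')
    (\<lambda>n. fa (PiF S \<odot> fpow (Tl S) (n + 1)) f)"
proof -
  interpret A: transposition S X w using w by unfold_locales
  interpret B: transposition S X' w' using w' by unfold_locales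
  interpret ZA: para_cocyclic_object C "Z_cosimp S X" "Z_cyc S X w" by (rule A.para_cocyclic_Z)
  interpret ZB: para_cocyclic_object C "Z_cosimp S X'" "Z_cyc S X' w'" by (rule B.para_cocyclic_Z)
  have f' [simp]: "f \<in> Arr M" "Dom M f = X" "Cod M f = X'" using f by (auto simp: hom_def)
  have om: "B.om n \<cdot>\<^bsub>M\<^esub> r (ln n f) = l (ln n f) \<cdot>\<^bsub>M\<^esub> A.om n" for n
  proof (induction n)
    case (Suc n)
    have "t (Ln n X') \<cdot>\<^bsub>M\<^esub> r (l (ln n f)) = l (r (ln n f)) \<cdot>\<^bsub>M\<^esub> t (Ln n X)"
      by (rule t_nat) simp_all
    then have "B.om (Suc n) \<cdot>\<^bsub>M\<^esub> r (ln (Suc n) f) = l (B.om n \<cdot>\<^bsub>M\<^esub> r (ln n f)) \<cdot>\<^bsub>M\<^esub> t (Ln n X)"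
      by simp
    then show ?case unfolding Suc.IH by simp
  qed (simp add: fw)
  show ?thesis
  proof (unfold_locales, goal_cases)
    case (1 n)
    show ?case by (rule C.homI) (simp_all add: Z_cosimp_sel)
  next
    case (2 n k)
    then obtain b where n: "n = k + b" by (auto elim: le_obtain)
    from 2 obtain c where c: "n = Suc c" by (cases n) auto
    have "l (ln b f) \<cdot>\<^bsub>M\<^esub> ul (Ln b X) = ul (Ln b X') \<cdot>\<^bsub>M\<^esub> ln b f"
      by (rule ul_nat[symmetric]) simp_all
    from p_ln_cong[OF this, of k]
    have "p (l (ln n f)) \<cdot>\<^bsub>C\<^esub> p (ln k (ul (Ln b X))) = p (ln k (ul (Ln b X'))) \<cdot>\<^bsub>C\<^esub> p (ln n f)"
      by (simp add: n fpow_add fpow_swap)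
    moreover have "n - k = b" "n - 1 = c" using n c by simp_all
    ultimately show ?case using c by (simp add: Z_cosimp_sel)
  next
    case (3 k n)
    then obtain b where n: "n = k + b" by (auto elim: le_obtain)
    have "l (ln b f) \<cdot>\<^bsub>M\<^esub> ml (Ln b X) = ml (Ln b X') \<cdot>\<^bsub>M\<^esub> l (l (ln b f))"
      by (rule ml_nat[symmetric]) simp_all
    from p_ln_cong[OF this, of k]
    show ?case by (simp add: Z_cosimp_sel n fpow_add fpow_swap)
  next
    case (4 n)
    have "i (Ln n X') \<cdot>\<^bsub>C\<^esub> p (l (ln n f)) = p (r (ln n f)) \<cdot>\<^bsub>C\<^esub> i (Ln n X)"
      by (rule i_nat) simp_all
    then have "Z_cyc S X' w' n \<cdot>\<^bsub>C\<^esub> p (l (ln n f)) = p (B.om n \<cdot>\<^bsub>M\<^esub> r (ln n f)) \<cdot>\<^bsub>C\<^esub> i (Ln n X)"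
      by (simp add: B.Z_cyc_eq)
    then show ?case unfolding om by (simp add: A.Z_cyc_eq)
  qed
qed

theorem theorem1p10:
  fixes S :: "('o, 'm, 'p, 'n) septuple" and X :: 'o and w :: 'm
  assumes "admissible_septuple S"
    and "transposition_morphism S X w"
  shows "para_cocyclic_object (catC S) (Z_cosimp S X) (Z_cyc S X w) \<and>
    (\<forall>X' w' f. f \<in> hom (W_cat S) (X, w) (X', w') \<longrightarrow>
      para_cocyclic_morphism (catC S)
        (Z_cosimp S X) (Z_cyc S X w) (Z_cosimp S X') (Z_cyc S X' w')
        (\<lambda>n. fa (PiF S \<odot> fpow (Tl S) (n + 1)) (W_under f)))"
proof (intro conjI allI impI)
  interpret transposition S X w using assms by unfold_locales
  show "para_cocyclic_object (catC S) (Z_cosimp S X) (Z_cyc S X w)"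
    by (rule para_cocyclic_Z)
  fix X' w' f
  assume "f \<in> hom (W_cat S) (X, w) (X', w')"
  then obtain g where "f = ((X, w), g, (X', w'))" and "transposition_morphism S X' w'"
    and "g \<in> hom M X X'" and "l g \<cdot>\<^bsub>M\<^esub> w = w' \<cdot>\<^bsub>M\<^esub> r g"
    \<comment> \<open>Instantiating \<open>hom_def\<close> at an explicit record unfolds the hom-set
      of \<open>W_cat S\<close> but keeps that of \<open>M\<close> folded.\<close>
    by (auto simp: W_cat_def
        hom_def[of "\<lparr>Obj = a, Arr = b, Dom = c, Cod = d, Ide = e, Comp = g\<rparr>" for a b c d e g])
  with assms(2) show "para_cocyclic_morphism (catC S)
        (Z_cosimp S X) (Z_cyc S X w) (Z_cosimp S X') (Z_cyc S X' w')
        (\<lambda>n. fa (PiF S \<odot> fpow (Tl S) (n + 1)) (W_under f))"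
    using para_cocyclic_morphism_Z by (simp add: W_under_def)
qed

end
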